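(* Let $Q$ be an IPC formula, $N \in \mathbb{N}$ and $Z_N, \dots, Z_0$ IPC formulas. Then $\mathcal{D}(Z_N, \dots, Z_0) \vdash QZ_0 \vee \cdots \vee QZ_N$, where the iterated disjunction is bracketed to the left: $D_0 = QZ_0$ and $D_{k+1} = D_k \vee QZ_{k+1}$, and $QZ_0 \vee \cdots \vee QZ_N$ denotes $D_N$.
   Context: The Implicational Propositional Calculus (IPC) has formulas built from propositional variables using only $\supset$, the single inference rule modus ponens, and the axiom schemes $X \supset (Y \supset X)$, $[X \supset (Y \supset Z)] \supset [(X \supset Y) \supset (X \supset Z)]$ and $[(X \supset Y) \supset X] \supset X$. $\Gamma \vdash X$ means $X$ is deducible in IPC from hypotheses $\Gamma$. For an IPC formula $Z$ write $QZ := Z \supset Q$. Disjunction is the abbreviation $X \vee Y := (X \supset Y) \supset Y$. For a sequence $\theta = (Z_N, \dots, Z_0)$ of IPC formulas, $\mathcal{D}(\theta) := Z_N \supset (Z_{N-1} \supset ( \cdots (Z_0 \supset Q) \cdots ))$; equivalently $\mathcal{D}(Z_0) = Z_0 \supset Q$ and $\mathcal{D}(W, \theta) = W \supset \mathcal{D}(\theta)$. *)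

theory Defs
  imports Main
begin

datatype 'v form =
    Var 'v
  | Imp "'v form" "'v form"  (infixr \<open>\<^bold>\<longrightarrow>\<close> 55)

inductive deducible :: "'v form set \<Rightarrow> 'v form \<Rightarrow> bool"  (infix \<open>\<turnstile>\<close> 50)
  for \<Gamma> :: "'v form set"
where
  hyp: "X \<in> \<Gamma> \<Longrightarrow> \<Gamma> \<turnstile> X"
| K: "\<Gamma> \<turnstile> X \<^bold>\<longrightarrow> (Y \<^bold>\<longrightarrow> X)"
| S: "\<Gamma> \<turnstile> (X \<^bold>\<longrightarrow> (Y \<^bold>\<longrightarrow> Z)) \<^bold>\<longrightarrow> ((X \<^bold>\<longrightarrow> Y) \<^bold>\<longrightarrow> (X \<^bold>\<longrightarrow> Z))"
| Peirce: "\<Gamma> \<turnstile> ((X \<^bold>\<longrightarrow> Y) \<^bold>\<longrightarrow> X) \<^bold>\<longrightarrow> X"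
| MP: "\<Gamma> \<turnstile> X \<^bold>\<longrightarrow> Y \<Longrightarrow> \<Gamma> \<turnstile> X \<Longrightarrow> \<Gamma> \<turnstile> Y"

abbreviation Or :: "'v form \<Rightarrow> 'v form \<Rightarrow> 'v form"  (infixl \<open>\<^bold>\<or>\<close> 60)
  where "X \<^bold>\<or> Y \<equiv> (X \<^bold>\<longrightarrow> Y) \<^bold>\<longrightarrow> Y"

abbreviation (input) Qneg :: "'v form \<Rightarrow> 'v form \<Rightarrow> 'v form"
  where "Qneg Q Z \<equiv> Z \<^bold>\<longrightarrow> Q"

text \<open>
  The list \<open>[Z\<^sub>N, \<dots>, Z\<^sub>0]\<close> is the sequence \<open>\<theta>\<close>, outermost antecedent first. The value at
  the empty list, which is not a sequence \<open>\<theta>\<close>, is the one that yields \<open>\<D> Q [Z\<^sub>0] = Z\<^sub>0 \<^bold>\<longrightarrow> Q\<close>.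
\<close>
primrec nested_Imp :: "'v form \<Rightarrow> 'v form list \<Rightarrow> 'v form"  (\<open>\<D>\<close>) where
  "\<D> Q [] = Q"
| "\<D> Q (W # \<theta>) = W \<^bold>\<longrightarrow> \<D> Q \<theta>"

primrec left_Or :: "(nat \<Rightarrow> 'v form) \<Rightarrow> nat \<Rightarrow> 'v form" where
  "left_Or X 0 = X 0"
| "left_Or X (Suc k) = left_Or X k \<^bold>\<or> X (Suc k)"

end

theory Submission
  imports Defs
begin

text \<open>
  By the deduction theorem, a proof of \<open>A \<^bold>\<or> (W \<^bold>\<longrightarrow> Q)\<close> may assume \<open>A \<^bold>\<longrightarrow> (W \<^bold>\<longrightarrow> Q)\<close> and \<open>W\<close>
  and has to reach \<open>Q\<close>. Detaching \<open>W\<close> from \<open>W \<^bold>\<longrightarrow> \<D> Q \<theta>\<close> leaves \<open>\<D> Q \<theta>\<close>, which yields \<open>A\<close>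
  by induction on the length, provided the induction ranges over all hypothesis sets.
\<close>

lemma deducible_mono:
  assumes "\<Gamma> \<turnstile> X" and "\<Gamma> \<subseteq> \<Delta>"
  shows "\<Delta> \<turnstile> X"
  using assms by (induction rule: deducible.induct) (auto intro: deducible.intros)

lemma Imp_refl: "\<Gamma> \<turnstile> X \<^bold>\<longrightarrow> X"
  \<comment> \<open>The combinator identity \<open>S K K = I\<close>, read as a derivation.\<close>
  by (rule MP [OF MP [OF S [where Y = "X \<^bold>\<longrightarrow> X"] K] K])

text \<open>Prefixing \<open>X\<close> to each formula of a derivation keeps it deducible:
  \<open>K\<close> handles axioms and members of \<open>\<Gamma>\<close>, \<open>Imp_refl\<close>
  handles \<open>X\<close> itself, \<open>S\<close> handles modus ponens.\<close>

lemma deduction_theorem: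
  assumes "insert X \<Gamma> \<turnstile> Y"
  shows "\<Gamma> \<turnstile> X \<^bold>\<longrightarrow> Y"
  using assms
proof (induction rule: deducible.induct)
  case (hyp Y)
  then show ?case
    using Imp_refl MP [OF K deducible.hyp] by blast
next
  case (MP Y Z)
  then show ?case
    using deducible.MP [OF deducible.MP [OF S]] by blast
qed (rule MP [OF K], rule deducible.intros)+

lemma left_Or_if_nested_Imp:
  assumes "\<Gamma> \<turnstile> \<D> Q (map Z (rev [0..<Suc N]))"
  shows "\<Gamma> \<turnstile> left_Or (\<lambda>k. Qneg Q (Z k)) N"
  using assms
proof (induction N arbitrary: \<Gamma>)
  case 0
  then show ?case by simp
next
  case (Suc N)
  let ?A = "left_Or (\<lambda>k. Qneg Q (Z k)) N" and ?W = "Z (Suc N)"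
  let ?\<Delta> = "insert ?W (insert (?A \<^bold>\<longrightarrow> (?W \<^bold>\<longrightarrow> Q)) \<Gamma>)"
  have W: "?\<Delta> \<turnstile> ?W"
    by (rule hyp) simp
  \<comment> \<open>The reversed range starts at \<open>Suc N\<close>, so \<open>?W\<close> is the
    outermost antecedent.\<close>
  have "\<Gamma> \<turnstile> ?W \<^bold>\<longrightarrow> \<D> Q (map Z (rev [0..<Suc N]))"
    using Suc.prems by simp
  then have "?\<Delta> \<turnstile> ?W \<^bold>\<longrightarrow> \<D> Q (map Z (rev [0..<Suc N]))"
    by (rule deducible_mono) blast
  then have "?\<Delta> \<turnstile> ?A"
    using W by (intro Suc.IH) (rule MP)
  moreover have "?\<Delta> \<turnstile> ?A \<^bold>\<longrightarrow> (?W \<^bold>\<longrightarrow> Q)"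
    by (rule hyp) simp
  ultimately have "?\<Delta> \<turnstile> Q"
    using W by (blast intro: MP)
  \<comment> \<open>Two discharges, in the order fixed by the insertions in
    \<open>?\<Delta>\<close>: \<open>?W\<close> comes off first.\<close>
  then show ?case
    by (simp add: deduction_theorem)
qed

theorem theorem6:
  fixes Q :: "'v form" and N :: nat and Z :: "nat \<Rightarrow> 'v form"
  shows "{\<D> Q (map Z (rev [0..<Suc N]))} \<turnstile> left_Or (\<lambda>k. Qneg Q (Z k)) N"
  by (rule left_Or_if_nested_Imp, rule hyp) simp

end
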